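(* Let $J_1=[0,\frac13]$, $J_2=[\frac23,1]$, and let $P=\frac1{100}P_1+\frac{99}{100}P_2$, where $P_1$ and $P_2$ are the uniform distributions on $J_1$ and $J_2$, respectively. For $n\geq3$, let $\alpha_n=\alpha_n(P)$ be an optimal set of $n$-means for $P$, and let $\mathrm{card}(\alpha_n\cap J_1)=k$. Then $\alpha_n$ contains $k$ elements from $J_1$ and $n-k$ elements from $J_2$, i.e., $\alpha_n(P)=\alpha_k(P_1)\cup\alpha_{n-k}(P_2)$, with quantization error \[V_n(P)=\frac1{10800}\Big(\frac1{k^2}+\frac{99}{(n-k)^2}\Big).\]
   Context: For a Borel probability measure $Q$ on $\mathbb{R}$ and $n\in\mathbb{N}$, the $n$th quantization error is $V_n(Q)=\inf\{\int\min_{a\in\alpha}(x-a)^2\,dQ(x) : \alpha\subset\mathbb{R},\ 1\le\mathrm{card}(\alpha)\le n\}$, and an optimal set of $n$-means for $Q$, denoted $\alpha_n(Q)$, is a set $\alpha$ with $1\le\mathrm{card}(\alpha)\le n$ attaining this infimum. *)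

theory Defs
  imports "HOL-Probability.Probability"
begin

text \<open>
  Distortions and quantization errors take values in \<^typ>\<open>ennreal\<close>, so that they are meaningful
  (possibly infinite) for every Borel probability measure, without an integrability assumption.
\<close>

definition distortion :: "real measure \<Rightarrow> real set \<Rightarrow> ennreal" where
  "distortion Q \<alpha> = (\<integral>\<^sup>+x. ennreal (Min ((\<lambda>a. (x - a)\<^sup>2) ` \<alpha>)) \<partial>Q)"

definition quantization_error :: "nat \<Rightarrow> real measure \<Rightarrow> ennreal" where
  "quantization_error n Q =
     (INF \<alpha> \<in> {\<alpha>. finite \<alpha> \<and> 1 \<le> card \<alpha> \<and> card \<alpha> \<le> n}. distortion Q \<alpha>)"

definition optimal_means :: "nat \<Rightarrow> real measure \<Rightarrow> real set \<Rightarrow> bool" where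
  "optimal_means n Q \<alpha> \<longleftrightarrow>
     finite \<alpha> \<and> 1 \<le> card \<alpha> \<and> card \<alpha> \<le> n \<and> distortion Q \<alpha> = quantization_error n Q"

definition mixture :: "real \<Rightarrow> real measure \<Rightarrow> real \<Rightarrow> real measure \<Rightarrow> real measure" where
  "mixture p M q N =
     measure_of UNIV (sets borel) (\<lambda>A. ennreal p * emeasure M A + ennreal q * emeasure N A)"

lemma sets_mixture [simp, measurable_cong]: "sets (mixture p M q N) = sets borel"
  unfolding mixture_def by (metis sets.sets_measure_of_eq space_borel)

lemma space_mixture [simp]: "space (mixture p M q N) = UNIV"
  using sets_eq_imp_space_eq[OF sets_mixture] by simp

lemma emeasure_mixture:
  assumes "sets M = sets borel" "sets N = sets borel" "A \<in> sets borel"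
  shows "emeasure (mixture p M q N) A = ennreal p * emeasure M A + ennreal q * emeasure N A"
proof (rule emeasure_measure_of[OF mixture_def])
  show "countably_additive (sets (mixture p M q N))
          (\<lambda>A. ennreal p * emeasure M A + ennreal q * emeasure N A)"
  proof (rule countably_additiveI)
    fix B :: "nat \<Rightarrow> real set"
    assume B: "range B \<subseteq> sets (mixture p M q N)" "disjoint_family B"
    have "(\<Sum>i. ennreal p * emeasure M (B i) + ennreal q * emeasure N (B i)) =
      ennreal p * (\<Sum>i. emeasure M (B i)) + ennreal q * (\<Sum>i. emeasure N (B i))"
      by (simp add: suminf_add[symmetric] ennreal_suminf_cmult)
    also have "\<dots> = ennreal p * emeasure M (\<Union>i. B i) + ennreal q * emeasure N (\<Union>i. B i)"
      using B assms by (simp add: suminf_emeasure)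
    finally show "(\<Sum>i. ennreal p * emeasure M (B i) + ennreal q * emeasure N (B i)) =
      ennreal p * emeasure M (\<Union>i. B i) + ennreal q * emeasure N (\<Union>i. B i)" .
  qed
qed (use assms in \<open>auto simp: positive_def\<close>)

definition J1 :: "real set" where "J1 = {0..1/3}"
definition J2 :: "real set" where "J2 = {2/3..1}"

definition P1 :: "real measure" where "P1 = uniform_measure lborel J1"
definition P2 :: "real measure" where "P2 = uniform_measure lborel J2"

definition P :: "real measure" where "P = mixture (1/100) P1 (99/100) P2"

lemma prob_space_P1: "prob_space P1"
  unfolding P1_def by (rule prob_space_uniform_measure) (simp_all add: J1_def)

lemma prob_space_P2: "prob_space P2"
  unfolding P2_def by (rule prob_space_uniform_measure) (simp_all add: J2_def)

lemma sets_P1 [simp, measurable_cong]: "sets P1 = sets borel"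
  and sets_P2 [simp, measurable_cong]: "sets P2 = sets borel"
  by (simp_all add: P1_def P2_def)

lemma prob_space_P: "prob_space P"
proof
  have "space P1 = UNIV" "space P2 = UNIV"
    using sets_eq_imp_space_eq[OF sets_P1] sets_eq_imp_space_eq[OF sets_P2] by simp_all
  then have "emeasure P1 UNIV = 1" "emeasure P2 UNIV = 1"
    using prob_space.emeasure_space_1[OF prob_space_P1]
      prob_space.emeasure_space_1[OF prob_space_P2] by simp_all
  then have "emeasure P UNIV = ennreal (1/100) + ennreal (99/100)"
    by (simp add: P_def emeasure_mixture)
  also have "\<dots> = 1"
    by (subst ennreal_plus[symmetric]) auto
  finally show "emeasure P (space P) = 1"
    by (simp add: P_def)
qed

end

theory Submission
  imports Defs
begin

text \<open>
  The proof rests on a pointwise estimate. For every radius \<open>r\<close> and every finite set \<open>\<alpha>\<close>,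

    \<open>r\<^sup>2 - (\<Sum>a\<in>\<alpha>. max 0 (r\<^sup>2 - (x - a)\<^sup>2)) \<le> min {(x - a)\<^sup>2 | a \<in> \<alpha>}\<close>,

  because the summand of the nearest point alone suffices. Each summand is a parabolic well of
  total mass \<open>4/3 r\<^sup>3\<close>, supported on the ball of radius \<open>r\<close> about \<open>a\<close>. Integrating over an interval
  of length \<open>L\<close> with \<open>r = L / (2m)\<close> therefore bounds the error of \<open>m\<close> points from below by
  \<open>L\<^sup>3 / (12 m\<^sup>2)\<close>, which the centres of \<open>m\<close> equal cells attain. The estimate carries two further pieces of information
  (\<open>interval_quantization\<close>): a point at distance at least \<open>r\<close> from the interval contributes nothing,
  so that only the other points have to be counted; and equality forces every counted well to lie
  entirely over the interval, hence every counted point to lie in it.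

  For the mixture, split an optimal set at \<open>1/2\<close> into a left part \<open>A\<close> with \<open>m\<close> points and a right part
  \<open>B\<close>. If neither is empty, both radii \<open>1/(6m)\<close> and \<open>1/(6(n-m))\<close> are at most \<open>1/6\<close>, which is the distance
  from \<open>1/2\<close> to either interval. So \<open>A\<close> alone is responsible for the first interval and \<open>B\<close> alone for
  the second, wherever their points lie, and the error is at least
  \<open>(1/m\<^sup>2 + 99/(n-m)\<^sup>2) / 10800\<close>. The union of two grids of \<open>m\<close> and \<open>n - m\<close> points has at most
  this error, so by optimality equality holds in both estimates, and the equality case puts \<open>A\<close> into
  the first interval and \<open>B\<close> into the second with no point missing. If \<open>A\<close> or \<open>B\<close> were empty, one
  interval would be served from across half of the gap, and the set would lose against one point in
  the first interval and \<open>n - 1\<close> in the second; only an empty \<open>A\<close> with \<open>n = 3\<close> is a close call.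
\<close>

section \<open>The squared distance to a finite set\<close>

definition sqdist :: "real set \<Rightarrow> real \<Rightarrow> real" where
  "sqdist \<alpha> x = Min ((\<lambda>a. (x - a)\<^sup>2) ` \<alpha>)"

lemma sqdist_le: "finite \<alpha> \<Longrightarrow> a \<in> \<alpha> \<Longrightarrow> sqdist \<alpha> x \<le> (x - a)\<^sup>2"
  unfolding sqdist_def by (intro Min_le) auto

lemma sqdist_attained:
  assumes "finite \<alpha>" "\<alpha> \<noteq> {}"
  obtains a where "a \<in> \<alpha>" "sqdist \<alpha> x = (x - a)\<^sup>2"
proof -
  have "sqdist \<alpha> x \<in> (\<lambda>a. (x - a)\<^sup>2) ` \<alpha>"
    unfolding sqdist_def using assms by (intro Min_in) auto
  then show thesis using that by blast
qed

lemma sqdist_nonneg: "finite \<alpha> \<Longrightarrow> \<alpha> \<noteq> {} \<Longrightarrow> 0 \<le> sqdist \<alpha> x"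
  by (metis sqdist_attained zero_le_power2)

lemma sqdist_antimono: "finite \<beta> \<Longrightarrow> \<alpha> \<subseteq> \<beta> \<Longrightarrow> \<alpha> \<noteq> {} \<Longrightarrow> sqdist \<beta> x \<le> sqdist \<alpha> x"
  unfolding sqdist_def by (intro Min_antimono) auto

lemma continuous_on_sqdist:
  assumes "finite \<alpha>" "\<alpha> \<noteq> {}"
  shows "continuous_on S (sqdist \<alpha>)"
  using assms
proof (induction rule: finite_ne_induct)
  case (singleton a)
  then show ?case by (auto simp: sqdist_def[abs_def] intro!: continuous_intros)
next
  case (insert a F)
  then have "sqdist (insert a F) = (\<lambda>x. min ((x - a)\<^sup>2) (sqdist F x))"
    by (simp add: sqdist_def fun_eq_iff)
  then show ?case using insert by (auto intro!: continuous_intros)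
qed

lemma sqdist_integrable:
  "finite \<alpha> \<Longrightarrow> \<alpha> \<noteq> {} \<Longrightarrow> sqdist \<alpha> integrable_on {c..d}"
  by (intro integrable_continuous_interval continuous_on_sqdist)

lemma has_integral_sq:
  fixes c d t :: real
  assumes "c \<le> d"
  shows "((\<lambda>x. (x - t)\<^sup>2) has_integral ((d - t) ^ 3 - (c - t) ^ 3) / 3) {c..d}"
proof -
  have "((\<lambda>x. (x - t) ^ 3 / 3) has_vector_derivative (x - t)\<^sup>2) (at x within {c..d})" for x
    by (auto intro!: derivative_eq_intros simp: has_real_derivative_iff_has_vector_derivative[symmetric])
  from fundamental_theorem_of_calculus[OF assms this] show ?thesis
    by (simp add: diff_divide_distrib)
qed


section \<open>Parabolic wells\<close>

text \<open>The part of the parabola with vertex at height \<open>r\<^sup>2\<close> above \<open>a\<close> that lies above the axis.\<close>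

definition well :: "real \<Rightarrow> real \<Rightarrow> real \<Rightarrow> real" where
  "well r a x = max 0 (r\<^sup>2 - (x - a)\<^sup>2)"

text \<open>
  An antiderivative of \<open>well r a\<close>: clamping \<open>x - a\<close> to \<open>[-r, r]\<close> makes it constant off the support, so
  that one formula covers all positions of the support relative to the interval of integration.
\<close>

definition well_prim :: "real \<Rightarrow> real \<Rightarrow> real \<Rightarrow> real" where
  "well_prim r a x = (let s = max (- r) (min r (x - a)) in r\<^sup>2 * s - s ^ 3 / 3)"

lemma well_has_integral:
  assumes "0 \<le> r" "c \<le> d"
  shows "(well r a has_integral well_prim r a d - well_prim r a c) {c..d}"
proof (rule fundamental_theorem_of_calculus_interior_strong[where S = "{a - r, a + r}"])
  show "continuous_on {c..d} (well_prim r a)"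
    unfolding well_prim_def[abs_def] Let_def by (intro continuous_intros) auto
next
  fix x assume x: "x \<in> {c<..<d} - {a - r, a + r}"
  \<comment> \<open>on each of the three pieces the clamping is trivial, so that the primitive is a polynomial\<close>
  consider "x < a - r" | "a - r < x" "x < a + r" | "a + r < x" using x by force
  then have "(well_prim r a has_real_derivative well r a x) (at x)"
  proof cases
    case 1
    then have "r\<^sup>2 \<le> (x - a)\<^sup>2" using assms by (intro abs_le_square_iff[THEN iffD1]) auto
    then have w: "well r a x = 0" by (simp add: well_def)
    have "((\<lambda>_. r\<^sup>2 * (- r) - (- r) ^ 3 / 3) has_real_derivative 0) (at x)" by simp
    then show ?thesis unfolding w
      by (rule has_field_derivative_transform_within_open[where S = "{..<a - r}"])
        (use 1 assms in \<open>auto simp: well_prim_def Let_def max_def min_def\<close>)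
  next
    case 2
    then have "(x - a)\<^sup>2 \<le> r\<^sup>2" using assms by (intro abs_le_square_iff[THEN iffD1]) auto
    then have w: "well r a x = r\<^sup>2 - (x - a)\<^sup>2" by (simp add: well_def)
    have "((\<lambda>x. r\<^sup>2 * (x - a) - (x - a) ^ 3 / 3) has_real_derivative r\<^sup>2 - (x - a)\<^sup>2) (at x)"
      by (auto intro!: derivative_eq_intros)
    then show ?thesis unfolding w
      by (rule has_field_derivative_transform_within_open[where S = "{a - r<..<a + r}"])
        (use 2 assms in \<open>auto simp: well_prim_def Let_def max_def min_def\<close>)
  next
    case 3
    then have "r\<^sup>2 \<le> (x - a)\<^sup>2" using assms by (intro abs_le_square_iff[THEN iffD1]) auto
    then have w: "well r a x = 0" by (simp add: well_def)
    have "((\<lambda>_. r\<^sup>2 * r - r ^ 3 / 3) has_real_derivative 0) (at x)" by simp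
    then show ?thesis unfolding w
      by (rule has_field_derivative_transform_within_open[where S = "{a + r<..}"])
        (use 3 assms in \<open>auto simp: well_prim_def Let_def max_def min_def\<close>)
  qed
  then show "(well_prim r a has_vector_derivative well r a x) (at x)"
    by (simp add: has_real_derivative_iff_has_vector_derivative)
qed (use assms in auto)

text \<open>
  The cubic is strictly increasing on \<open>[-r, r]\<close>. The proof factors its distance to either extreme
  value, since the equality cases are what locates the points of an optimal set.
\<close>

lemma cubic_extremes:
  fixes r s :: real
  assumes "- r \<le> s" "s \<le> r" "0 < r"
  shows "r\<^sup>2 * s - s ^ 3 / 3 \<le> 2 / 3 * r ^ 3"
    and "r\<^sup>2 * s - s ^ 3 / 3 = 2 / 3 * r ^ 3 \<Longrightarrow> s = r"
    and "- (2 / 3 * r ^ 3) \<le> r\<^sup>2 * s - s ^ 3 / 3"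
    and "r\<^sup>2 * s - s ^ 3 / 3 = - (2 / 3 * r ^ 3) \<Longrightarrow> s = - r"
proof -
  have 1: "2 / 3 * r ^ 3 - (r\<^sup>2 * s - s ^ 3 / 3) = (r - s)\<^sup>2 * (2 * r + s) / 3"
    and 2: "(r\<^sup>2 * s - s ^ 3 / 3) + 2 / 3 * r ^ 3 = (r + s)\<^sup>2 * (2 * r - s) / 3"
    by (auto simp: field_simps power2_eq_square power3_eq_cube)
  have "0 \<le> (r - s)\<^sup>2 * (2 * r + s) / 3" "0 \<le> (r + s)\<^sup>2 * (2 * r - s) / 3"
    using assms by auto
  with 1 2 show "r\<^sup>2 * s - s ^ 3 / 3 \<le> 2 / 3 * r ^ 3" "- (2 / 3 * r ^ 3) \<le> r\<^sup>2 * s - s ^ 3 / 3"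
    by linarith+
  show "s = r" if "r\<^sup>2 * s - s ^ 3 / 3 = 2 / 3 * r ^ 3" using 1 that assms by auto
  show "s = - r" if "r\<^sup>2 * s - s ^ 3 / 3 = - (2 / 3 * r ^ 3)" using 2 that assms by auto
qed

lemma well_integral_le:
  assumes "0 < r"
  shows "well_prim r a d - well_prim r a c \<le> 4 / 3 * r ^ 3"
    and "well_prim r a d - well_prim r a c = 4 / 3 * r ^ 3 \<Longrightarrow> c + r \<le> a \<and> a \<le> d - r"
proof -
  define s t where "s = max (- r) (min r (d - a))" and "t = max (- r) (min r (c - a))"
  have b: "- r \<le> s" "s \<le> r" "- r \<le> t" "t \<le> r" using assms by (auto simp: s_def t_def)
  have e: "well_prim r a d = r\<^sup>2 * s - s ^ 3 / 3" "well_prim r a c = r\<^sup>2 * t - t ^ 3 / 3"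
    by (simp_all add: well_prim_def s_def t_def Let_def)
  note cs = cubic_extremes[OF b(1,2) assms] and ct = cubic_extremes[OF b(3,4) assms]
  show "well_prim r a d - well_prim r a c \<le> 4 / 3 * r ^ 3" using cs(1) ct(3) e by linarith
  assume "well_prim r a d - well_prim r a c = 4 / 3 * r ^ 3"
  then have "s = r" "t = - r" using cs ct e by linarith+
  then show "c + r \<le> a \<and> a \<le> d - r" unfolding s_def t_def using assms by linarith
qed

lemma well_integral_inside:
  assumes "0 < r" "c + r \<le> a" "a \<le> d - r"
  shows "well_prim r a d - well_prim r a c = 4 / 3 * r ^ 3"
proof -
  have "max (- r) (min r (d - a)) = r" "max (- r) (min r (c - a)) = - r" using assms by auto
  then show ?thesis by (simp add: well_prim_def Let_def power2_eq_square power3_eq_cube)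
qed

lemma well_integral_outside:
  assumes "0 < r" "c \<le> d" "a \<le> c - r \<or> d + r \<le> a"
  shows "well_prim r a d - well_prim r a c = 0"
proof -
  have "max (- r) (min r (d - a)) = max (- r) (min r (c - a))" using assms by linarith
  then show ?thesis by (simp add: well_prim_def Let_def)
qed

text \<open>
  The wells are nonnegative, and the well of the point nearest to \<open>x\<close> is already at least
  \<open>r\<^sup>2 - sqdist \<alpha> x\<close>.
\<close>

lemma sqdist_ge_wells:
  assumes "finite \<alpha>" "\<alpha> \<noteq> {}"
  shows "r\<^sup>2 - (\<Sum>a\<in>\<alpha>. well r a x) \<le> sqdist \<alpha> x"
proof -
  obtain a where a: "a \<in> \<alpha>" "sqdist \<alpha> x = (x - a)\<^sup>2" using sqdist_attained assms by metis
  have "r\<^sup>2 - (x - a)\<^sup>2 \<le> well r a x" by (simp add: well_def)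
  also have "\<dots> \<le> (\<Sum>a\<in>\<alpha>. well r a x)"
    using assms a(1) by (intro member_le_sum) (auto simp: well_def)
  finally show ?thesis using a by linarith
qed


section \<open>Quantization of an interval\<close>

text \<open>
  Integrate the pointwise estimate with \<open>r = (d - c) / (2m)\<close>, the radius for which \<open>m\<close> balls exactly
  fill the interval. Points outside \<open>\<beta>\<close> are so far away that their wells vanish on it, and each of
  the at most \<open>m\<close> wells of \<open>\<beta>\<close> contributes at most its total mass \<open>4/3 r\<^sup>3\<close>. Equality leaves no room
  for a missing point or for a well that sticks out of the interval. Allowing \<open>card \<beta> < m\<close> (even
  \<open>\<beta> = {}\<close>) lets \<open>m\<close> be any budget of points and not just their actual number.
\<close>

lemma interval_quantization:
  fixes c d :: real
  assumes \<alpha>: "finite \<alpha>" "\<alpha> \<noteq> {}" and cd: "c < d"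
    and \<beta>: "\<beta> \<subseteq> \<alpha>" "card \<beta> \<le> m" and m: "1 \<le> m"
    and far: "\<And>a. a \<in> \<alpha> - \<beta> \<Longrightarrow> a \<le> c - (d - c) / (2 * real m) \<or> d + (d - c) / (2 * real m) \<le> a"
  shows "(d - c) ^ 3 / (12 * (real m)\<^sup>2) \<le> integral {c..d} (sqdist \<alpha>)"
    and "integral {c..d} (sqdist \<alpha>) = (d - c) ^ 3 / (12 * (real m)\<^sup>2) \<Longrightarrow> card \<beta> = m \<and> \<beta> \<subseteq> {c..d}"
proof -
  define r where "r = (d - c) / (2 * real m)"
  define w where "w a = well_prim r a d - well_prim r a c" for a
  have r: "0 < r" and dc: "d - c = 2 * real m * r" using cd m by (auto simp: r_def)
  have r3: "0 < r ^ 3" using r by simp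
  have fin: "finite \<beta>" using \<alpha> \<beta> finite_subset by blast
  have ww: "(well r a has_integral w a) {c..d}" for a
    unfolding w_def using r cd by (intro well_has_integral) auto
  have "((\<lambda>x. r\<^sup>2 - (\<Sum>a\<in>\<alpha>. well r a x)) has_integral (d - c) * r\<^sup>2 - (\<Sum>a\<in>\<alpha>. w a)) {c..d}"
    using has_integral_const_real[of "r\<^sup>2" c d] cd \<alpha> ww
    by (intro has_integral_diff has_integral_sum) auto
  then have "(d - c) * r\<^sup>2 - (\<Sum>a\<in>\<alpha>. w a) \<le> integral {c..d} (sqdist \<alpha>)"
    using sqdist_integrable[OF \<alpha>] sqdist_ge_wells[OF \<alpha>]
    by (intro has_integral_le[OF _ integrable_integral]) auto
  moreover have "(\<Sum>a\<in>\<alpha>. w a) = (\<Sum>a\<in>\<beta>. w a)"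
    using \<alpha> \<beta> far cd r unfolding w_def r_def[symmetric]
    by (intro sum.mono_neutral_right ballI well_integral_outside) auto
  ultimately have lb: "(d - c) * r\<^sup>2 - (\<Sum>a\<in>\<beta>. w a) \<le> integral {c..d} (sqdist \<alpha>)" by simp
  have wle: "w a \<le> 4 / 3 * r ^ 3" for a unfolding w_def by (rule well_integral_le[OF r])
  have s1: "(\<Sum>a\<in>\<beta>. w a) \<le> real (card \<beta>) * (4 / 3 * r ^ 3)"
    using sum_bounded_above[of \<beta> w "4 / 3 * r ^ 3"] wle by simp
  have s2: "real (card \<beta>) * (4 / 3 * r ^ 3) \<le> real m * (4 / 3 * r ^ 3)"
    using \<beta> r3 by (intro mult_right_mono) auto
  have val: "(d - c) * r\<^sup>2 - real m * (4 / 3 * r ^ 3) = (d - c) ^ 3 / (12 * (real m)\<^sup>2)"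
    unfolding dc using m by (simp add: field_simps power2_eq_square power3_eq_cube)
  show "(d - c) ^ 3 / (12 * (real m)\<^sup>2) \<le> integral {c..d} (sqdist \<alpha>)"
    using lb s1 s2 val by linarith
  assume eq: "integral {c..d} (sqdist \<alpha>) = (d - c) ^ 3 / (12 * (real m)\<^sup>2)"
  have "real (card \<beta>) * (4 / 3 * r ^ 3) = real m * (4 / 3 * r ^ 3)"
    using lb s1 s2 val eq by linarith
  then have card: "card \<beta> = m" using r3 by simp
  have "(\<Sum>a\<in>\<beta>. 4 / 3 * r ^ 3 - w a) = 0"
    using lb s1 s2 val eq by (simp add: sum_subtractf)
  then have "\<forall>a\<in>\<beta>. 4 / 3 * r ^ 3 - w a = 0"
    using fin wle by (subst (asm) sum_nonneg_eq_0_iff) (auto simp: algebra_simps)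
  then have "a \<in> {c..d}" if "a \<in> \<beta>" for a
    using well_integral_le(2)[OF r, of a d c] that r by (force simp: w_def)
  with card show "card \<beta> = m \<and> \<beta> \<subseteq> {c..d}" by auto
qed

text \<open>The centres of \<open>m\<close> cells of equal length.\<close>

definition grid :: "real \<Rightarrow> real \<Rightarrow> nat \<Rightarrow> real set" where
  "grid c d m = (\<lambda>i. c + (2 * real i + 1) * ((d - c) / (2 * real m))) ` {..<m}"

lemma grid_props:
  assumes "1 \<le> m"
  shows "finite (grid c d m)" "grid c d m \<noteq> {}" "card (grid c d m) \<le> m"
  using assms card_image_le[of "{..<m}"] by (auto simp: grid_def lessThan_empty_iff bot_nat_def)

text \<open>
  For the grid the wells have disjoint interiors and fill the interval, so that the pointwise
  estimate becomes an equality: at each \<open>x\<close> only the well of the cell around \<open>x\<close> is nonzero.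
\<close>

lemma integral_grid_le:
  assumes cd: "c < d" and m: "1 \<le> m"
  shows "integral {c..d} (sqdist (grid c d m)) \<le> (d - c) ^ 3 / (12 * (real m)\<^sup>2)"
proof -
  define r where "r = (d - c) / (2 * real m)"
  define p where "p i = c + (2 * real i + 1) * r" for i
  have r: "0 < r" and dc: "d = c + 2 * real m * r" using cd m by (auto simp: r_def)
  have grid: "grid c d m = p ` {..<m}" by (simp add: grid_def p_def r_def)
  have key: "sqdist (grid c d m) x \<le> r\<^sup>2 - (\<Sum>i<m. well r (p i) x)" if x: "x \<in> {c..d}" for x
  proof -
    \<comment> \<open>the left-closed cells miss the right end point, which belongs to the last cell\<close>
    define i where "i = min (m - 1) (nat \<lfloor>(x - c) / (2 * r)\<rfloor>)"
    have im: "i < m" using m by (simp add: i_def)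
    have q0: "0 \<le> (x - c) / (2 * r)" "(x - c) / (2 * r) \<le> real m"
      using x r by (auto simp: dc divide_simps mult_ac)
    have "real i \<le> (x - c) / (2 * r) \<and> (x - c) / (2 * r) \<le> real i + 1"
    proof (cases "nat \<lfloor>(x - c) / (2 * r)\<rfloor> \<le> m - 1")
      case True
      then have "real i = of_int \<lfloor>(x - c) / (2 * r)\<rfloor>" using q0 by (simp add: i_def)
      then show ?thesis by linarith
    next
      case False
      then have "i = m - 1" "real m \<le> real (nat \<lfloor>(x - c) / (2 * r)\<rfloor>)" by (auto simp: i_def)
      moreover have "real (nat \<lfloor>(x - c) / (2 * r)\<rfloor>) \<le> (x - c) / (2 * r)"
        using q0 of_int_floor_le[of "(x - c) / (2 * r)"] by simp
      moreover have "real (m - 1) = real m - 1" using m by simp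
      ultimately show ?thesis using q0 by linarith
    qed
    then have cell: "2 * real i * r \<le> x - c" "x - c \<le> 2 * (real i + 1) * r"
      using r by (auto simp: field_simps)
    have other: "well r (p j) x = 0" if "j \<noteq> i" for j
    proof -
      have "r \<le> \<bar>x - p j\<bar>"
      proof (cases "j < i")
        case True
        then have "(real j + 1) * r \<le> real i * r" using r by (intro mult_right_mono) auto
        then show ?thesis using cell unfolding p_def by (simp add: algebra_simps)
      next
        case False
        then have "(real i + 1) * r \<le> real j * r" using that r by (intro mult_right_mono) auto
        then show ?thesis using cell unfolding p_def by (simp add: algebra_simps)
      qed
      then have "r\<^sup>2 \<le> (x - p j)\<^sup>2" using r by (intro abs_le_square_iff[THEN iffD1]) auto
      then show ?thesis by (simp add: well_def)
    qed
    have "\<bar>x - p i\<bar> \<le> r" using cell unfolding p_def by (simp add: algebra_simps abs_le_iff)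
    then have "(x - p i)\<^sup>2 \<le> r\<^sup>2" using r by (intro abs_le_square_iff[THEN iffD1]) auto
    then have "well r (p i) x = r\<^sup>2 - (x - p i)\<^sup>2" by (simp add: well_def)
    moreover have "(\<Sum>j<m. well r (p j) x) = well r (p i) x"
      using im other by (subst sum.remove[of _ i]) auto
    moreover have "sqdist (grid c d m) x \<le> (x - p i)\<^sup>2"
      using im by (intro sqdist_le) (auto simp: grid)
    ultimately show ?thesis by simp
  qed
  have "(well r (p i) has_integral 4 / 3 * r ^ 3) {c..d}" if "i < m" for i
  proof -
    have "real i * r \<ge> 0" "(real i + 1) * r \<le> real m * r"
      using r that by (auto intro!: mult_right_mono)
    then have "c + r \<le> p i" "p i \<le> d - r" unfolding p_def dc by (auto simp: algebra_simps)
    then show ?thesis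
      using well_has_integral[of r c d "p i"] well_integral_inside[OF r, of c "p i" d] r cd by simp
  qed
  then have "((\<lambda>x. r\<^sup>2 - (\<Sum>i<m. well r (p i) x)) has_integral
      (d - c) * r\<^sup>2 - (\<Sum>i<m. 4 / 3 * r ^ 3)) {c..d}"
    using has_integral_const_real[of "r\<^sup>2" c d] cd
    by (intro has_integral_diff has_integral_sum) auto
  then have "integral {c..d} (sqdist (grid c d m)) \<le> (d - c) * r\<^sup>2 - (\<Sum>i<m. 4 / 3 * r ^ 3)"
    using sqdist_integrable[OF grid_props(1,2)[OF m]] key
    by (intro has_integral_le[OF integrable_integral]) auto
  also have "\<dots> = (d - c) ^ 3 / (12 * (real m)\<^sup>2)"
    unfolding dc using m by (simp add: field_simps power2_eq_square power3_eq_cube)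
  finally show ?thesis .
qed


section \<open>Distortions as integrals\<close>

lemma nn_integral_mixture:
  assumes M: "sets M = sets borel" and N: "sets N = sets borel" and f: "f \<in> borel_measurable borel"
  shows "(\<integral>\<^sup>+x. f x \<partial>mixture p M q N) = ennreal p * (\<integral>\<^sup>+x. f x \<partial>M) + ennreal q * (\<integral>\<^sup>+x. f x \<partial>N)"
  using f
proof (induction rule: borel_measurable_induct)
  case (cong f g)
  then have "f = g" by auto
  with cong show ?case by simp
next
  case (set A)
  then show ?case using M N by (simp add: emeasure_mixture)
next
  case (mult u c)
  then show ?case using M N
    by (simp add: nn_integral_cmult distrib_left mult.left_commute cong: measurable_cong_sets)
next
  case (add u v)
  then show ?case using M N
    by (simp add: nn_integral_add distrib_left add_ac cong: measurable_cong_sets)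
next
  case (seq U)
  have mU: "U i \<in> borel_measurable M" "U i \<in> borel_measurable N"
      "U i \<in> borel_measurable (mixture p M q N)" for i
    using seq M N by (simp_all cong: measurable_cong_sets)
  have inc: "incseq (\<lambda>i. ennreal p * (\<integral>\<^sup>+x. U i x \<partial>M))" "incseq (\<lambda>i. ennreal q * (\<integral>\<^sup>+x. U i x \<partial>N))"
    using seq by (auto simp: incseq_def le_fun_def intro!: mult_left_mono nn_integral_mono)
  show ?case
    using seq mU inc
    by (simp add: image_comp nn_integral_monotone_convergence_SUP
      SUP_mult_left_ennreal ennreal_SUP_add)
qed

lemma distortion_uniform:
  assumes "finite \<alpha>" "\<alpha> \<noteq> {}" "c < d"
  shows "distortion (uniform_measure lborel {c..d}) \<alpha> = ennreal (integral {c..d} (sqdist \<alpha>) / (d - c))"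
proof -
  have meas: "sqdist \<alpha> \<in> borel_measurable borel"
    using continuous_on_sqdist[OF assms(1,2)] by (rule borel_measurable_continuous_onI)
  have "distortion (uniform_measure lborel {c..d}) \<alpha>
      = (\<integral>\<^sup>+x. ennreal (sqdist \<alpha> x) * indicator {c..d} x \<partial>lborel) / emeasure lborel {c..d}"
    unfolding distortion_def sqdist_def[symmetric] using meas
    by (subst nn_integral_uniform_measure) auto
  also have "(\<integral>\<^sup>+x. ennreal (sqdist \<alpha> x) * indicator {c..d} x \<partial>lborel)
      = (\<integral>\<^sup>+x. ennreal (if x \<in> {c..d} then sqdist \<alpha> x else 0) \<partial>lborel)"
    by (intro nn_integral_cong) (auto split: split_indicator)
  also have "\<dots> = ennreal (integral {c..d} (sqdist \<alpha>))"
  proof (rule nn_integral_has_integral_lborel)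
    show "(\<lambda>x. if x \<in> {c..d} then sqdist \<alpha> x else 0) \<in> borel_measurable borel"
      using meas by measurable
    show "((\<lambda>x. if x \<in> {c..d} then sqdist \<alpha> x else 0) has_integral integral {c..d} (sqdist \<alpha>)) UNIV"
      unfolding has_integral_restrict_UNIV
      using sqdist_integrable[OF assms(1,2)] by (rule integrable_integral)
  qed (simp add: sqdist_nonneg assms)
  finally show ?thesis using assms
    by (simp add: divide_ennreal integral_nonneg sqdist_integrable sqdist_nonneg)
qed

lemma distortion_P1:
  "finite \<alpha> \<Longrightarrow> \<alpha> \<noteq> {} \<Longrightarrow> distortion P1 \<alpha> = ennreal (3 * integral {0..1/3} (sqdist \<alpha>))"
  unfolding P1_def J1_def by (subst distortion_uniform) (auto simp: mult.commute)

lemma distortion_P2: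
  "finite \<alpha> \<Longrightarrow> \<alpha> \<noteq> {} \<Longrightarrow> distortion P2 \<alpha> = ennreal (3 * integral {2/3..1} (sqdist \<alpha>))"
  unfolding P2_def J2_def by (subst distortion_uniform) (auto simp: mult.commute)

lemma distortion_P:
  assumes "finite \<alpha>" "\<alpha> \<noteq> {}"
  shows "distortion P \<alpha> =
    ennreal (3/100 * integral {0..1/3} (sqdist \<alpha>) + 297/100 * integral {2/3..1} (sqdist \<alpha>))"
proof -
  have "sqdist \<alpha> \<in> borel_measurable borel"
    using continuous_on_sqdist[OF assms] by (rule borel_measurable_continuous_onI)
  then have "distortion P \<alpha> = ennreal (1/100) * distortion P1 \<alpha> + ennreal (99/100) * distortion P2 \<alpha>"
    unfolding distortion_def P_def sqdist_def[symmetric] by (intro nn_integral_mixture) auto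
  also have "\<dots> = ennreal (1/100 * (3 * integral {0..1/3} (sqdist \<alpha>)) +
      99/100 * (3 * integral {2/3..1} (sqdist \<alpha>)))"
    using assms
    by (simp add: distortion_P1 distortion_P2 ennreal_mult[symmetric] ennreal_plus[symmetric]
      integral_nonneg sqdist_integrable sqdist_nonneg del: ennreal_plus)
  finally show ?thesis by simp
qed

text \<open>
  The assumed value is the lower bound for every competitor, so reaching it is optimality.
\<close>

lemma optimal_means_uniform:
  assumes "c < d" "1 \<le> m" "finite \<alpha>" "\<alpha> \<noteq> {}" "card \<alpha> \<le> m"
    and le: "integral {c..d} (sqdist \<alpha>) \<le> (d - c) ^ 3 / (12 * (real m)\<^sup>2)"
  shows "optimal_means m (uniform_measure lborel {c..d}) \<alpha>"
proof -
  have "distortion (uniform_measure lborel {c..d}) \<alpha> \<le> distortion (uniform_measure lborel {c..d}) \<beta>"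
    if "finite \<beta>" "1 \<le> card \<beta>" "card \<beta> \<le> m" for \<beta>
  proof -
    have ne: "\<beta> \<noteq> {}" using that by auto
    have "integral {c..d} (sqdist \<alpha>) \<le> integral {c..d} (sqdist \<beta>)"
      using le interval_quantization(1)[of \<beta> c d \<beta> m] that ne assms by simp
    then show ?thesis
      using that ne assms by (auto simp: distortion_uniform intro!: ennreal_leI divide_right_mono)
  qed
  moreover have "1 \<le> card \<alpha>" using assms by (simp add: Suc_le_eq card_gt_0_iff)
  ultimately show ?thesis
    using assms unfolding optimal_means_def quantization_error_def
    by (intro conjI antisym INF_greatest INF_lower) auto
qed


section \<open>The mixture\<close>

lemma quantization_error_P_le:
  assumes "1 \<le> k" "1 \<le> l" "k + l \<le> n"
  shows "quantization_error n P \<le> ennreal (1 / 10800 * (1 / (real k)\<^sup>2 + 99 / (real l)\<^sup>2))"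
proof -
  define A B where "A = grid 0 (1/3) k" and "B = grid (2/3) 1 l"
  have A: "finite A" "A \<noteq> {}" "card A \<le> k" and B: "finite B" "B \<noteq> {}" "card B \<le> l"
    using grid_props assms unfolding A_def B_def by auto
  have AB: "finite (A \<union> B)" "A \<union> B \<noteq> {}" "card (A \<union> B) \<le> n"
    using A B assms card_Un_le[of A B] by auto
  have "1 \<le> card (A \<union> B)" using AB by (simp add: Suc_le_eq card_gt_0_iff)
  then have "quantization_error n P \<le> distortion P (A \<union> B)"
    using AB unfolding quantization_error_def by (intro INF_lower) auto
  also have "\<dots> \<le> ennreal (1 / 10800 * (1 / (real k)\<^sup>2 + 99 / (real l)\<^sup>2))"
    unfolding distortion_P[OF AB(1,2)]
  proof (rule ennreal_leI)
    have "integral {0..1/3} (sqdist (A \<union> B)) \<le> integral {0..1/3} (sqdist A)"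
      using A AB by (intro integral_le sqdist_integrable sqdist_antimono) auto
    also have "\<dots> \<le> (1/3) ^ 3 / (12 * (real k)\<^sup>2)"
      unfolding A_def using integral_grid_le[of 0 "1/3" k] assms by simp
    finally have 1: "integral {0..1/3} (sqdist (A \<union> B)) \<le> 1 / 324 * (1 / (real k)\<^sup>2)"
      by (simp add: power3_eq_cube)
    have "integral {2/3..1} (sqdist (A \<union> B)) \<le> integral {2/3..1} (sqdist B)"
      using B AB by (intro integral_le sqdist_integrable sqdist_antimono) auto
    also have "\<dots> \<le> (1/3) ^ 3 / (12 * (real l)\<^sup>2)"
      unfolding B_def using integral_grid_le[of "2/3" 1 l] assms by simp
    finally have 2: "integral {2/3..1} (sqdist (A \<union> B)) \<le> 1 / 324 * (1 / (real l)\<^sup>2)"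
      by (simp add: power3_eq_cube)
    show "3/100 * integral {0..1/3} (sqdist (A \<union> B)) + 297/100 * integral {2/3..1} (sqdist (A \<union> B))
      \<le> 1 / 10800 * (1 / (real k)\<^sup>2 + 99 / (real l)\<^sup>2)"
      using 1 2 by (simp add: field_simps)
  qed
  finally show ?thesis .
qed

text \<open>
  This bounds the error on an interval that is served only from beyond \<open>t\<close>: the single
  point \<open>t\<close> would do at least as well.
\<close>

lemma integral_sqdist_ge_sq:
  assumes "finite \<alpha>" "\<alpha> \<noteq> {}" "c \<le> d"
    and "\<And>a x. a \<in> \<alpha> \<Longrightarrow> x \<in> {c..d} \<Longrightarrow> \<bar>x - t\<bar> \<le> \<bar>x - a\<bar>"
  shows "((d - t) ^ 3 - (c - t) ^ 3) / 3 \<le> integral {c..d} (sqdist \<alpha>)"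
proof (rule has_integral_le[OF has_integral_sq[OF assms(3)] integrable_integral])
  fix x assume x: "x \<in> {c..d}"
  obtain a where "a \<in> \<alpha>" "sqdist \<alpha> x = (x - a)\<^sup>2" using sqdist_attained assms by metis
  then show "(x - t)\<^sup>2 \<le> sqdist \<alpha> x" using assms(4) x by (simp add: abs_le_square_iff)
qed (intro sqdist_integrable assms)

lemma interval_third_quantization:
  fixes c :: real
  assumes "finite \<alpha>" "\<alpha> \<noteq> {}" "\<beta> \<subseteq> \<alpha>" "card \<beta> \<le> m" "1 \<le> m" "d = c + 1/3"
    and "\<And>a. a \<in> \<alpha> - \<beta> \<Longrightarrow> a \<le> c - 1 / (6 * real m) \<or> d + 1 / (6 * real m) \<le> a"
  shows "1 / 324 * (1 / (real m)\<^sup>2) \<le> integral {c..d} (sqdist \<alpha>)"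
    and "integral {c..d} (sqdist \<alpha>) = 1 / 324 * (1 / (real m)\<^sup>2) \<Longrightarrow> card \<beta> = m \<and> \<beta> \<subseteq> {c..d}"
  using interval_quantization[of \<alpha> c d \<beta> m] assms by (simp_all add: power3_eq_cube)

theorem theorem3p4p7:
  fixes n k :: nat and \<alpha> :: "real set"
  assumes "n \<ge> 3"
    and "optimal_means n P \<alpha>"
    and "card (\<alpha> \<inter> J1) = k"
  shows "card (\<alpha> \<inter> J2) = n - k
    \<and> \<alpha> = (\<alpha> \<inter> J1) \<union> (\<alpha> \<inter> J2)
    \<and> optimal_means k P1 (\<alpha> \<inter> J1)
    \<and> optimal_means (n - k) P2 (\<alpha> \<inter> J2)
    \<and> quantization_error n P =
        ennreal (1 / 10800 * (1 / (real k)\<^sup>2 + 99 / (real (n - k))\<^sup>2))"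
proof -
  define E where "E k l = 1 / 10800 * (1 / (real k)\<^sup>2 + 99 / (real l)\<^sup>2)" for k l
  define D1 D2 where "D1 = integral {0..1/3} (sqdist \<alpha>)" and "D2 = integral {2/3..1} (sqdist \<alpha>)"
  have fin: "finite \<alpha>" and ne: "\<alpha> \<noteq> {}" and card: "card \<alpha> \<le> n"
    using assms(2) by (auto simp: optimal_means_def)
  have D: "0 \<le> D1" "0 \<le> D2"
    using fin ne by (auto simp: D1_def D2_def intro!: integral_nonneg sqdist_integrable sqdist_nonneg)
  have V: "quantization_error n P = ennreal (3/100 * D1 + 297/100 * D2)"
    using assms(2) distortion_P[OF fin ne] by (simp add: optimal_means_def D1_def D2_def)
  have T: "3/100 * D1 + 297/100 * D2 \<le> E k l" if "1 \<le> k" "1 \<le> l" "k + l \<le> n" for k l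
    using quantization_error_P_le[OF that] V by (simp add: E_def ennreal_le_iff)
  have T1: "3/100 * D1 + 297/100 * D2 \<le> E 1 (n - 1)" using T assms(1) by simp

  \<comment> \<open>\<open>1/2\<close> is the centre of the gap: its distance \<open>1/6\<close> to either interval is the largest radius
      that occurs below\<close>
  define A B where "A = {a \<in> \<alpha>. a < 1/2}" and "B = {a \<in> \<alpha>. 1/2 \<le> a}"
  have AB: "\<alpha> = A \<union> B" "A \<inter> B = {}" "finite A" "finite B" using fin by (auto simp: A_def B_def)
  have cAB: "card A + card B \<le> n" using card AB by (simp add: card_Un_disjoint)

  have A_ne: "A \<noteq> {}"
  proof
    assume "A = {}"
    then have ge: "1/2 \<le> a" if "a \<in> \<alpha>" for a using that by (force simp: A_def)
    \<comment> \<open>In units of \<open>1/10800\<close> the competitor costs \<open>1 + 99/(n-1)\<^sup>2\<close>. Serving the first interval from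
        \<open>1/2\<close> costs \<open>13\<close>, which does not suffice for \<open>n = 3\<close> together with the bound \<open>99/n\<^sup>2\<close> for the second one.
        The threshold \<open>7/12 = 2/3 - 1/12\<close> separates points too far from the second interval to help
        there (as the radius is at most \<open>1/12\<close>) from points so far from the first that it costs \<open>79/4\<close>.\<close>
    show False
    proof (cases "\<exists>a\<in>\<alpha>. a < 7/12")
      case True
      then obtain a where a: "a \<in> \<alpha>" "a < 7/12" by blast
      have "((1/3 - 1/2) ^ 3 - (0 - 1/2) ^ 3) / 3 \<le> D1"
        unfolding D1_def by (rule integral_sqdist_ge_sq[OF fin ne]) (auto dest!: ge)
      then have D1': "13/324 \<le> D1" by (simp add: power3_eq_cube)
      have "1 / (6 * real (n - 1)) \<le> 1 / 12" using assms(1) by (intro divide_left_mono) auto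
      moreover have "a \<le> 2/3 - r" if "r \<le> 1 / 12" for r using a(2) that by linarith
      ultimately have "a \<le> 2/3 - 1 / (6 * real (n - 1))" by blast
      then have D2': "1 / 324 * (1 / (real (n - 1))\<^sup>2) \<le> D2"
        unfolding D2_def using fin ne a(1) card assms(1)
        by (intro interval_third_quantization(1)[of \<alpha> "\<alpha> - {a}"]) (auto simp: card_Diff_singleton)
      show False using T1 D1' D2' by (simp add: E_def)
    next
      case False
      then have ge': "7/12 \<le> a" if "a \<in> \<alpha>" for a using that by force
      have "((1/3 - 7/12) ^ 3 - (0 - 7/12) ^ 3) / 3 \<le> D1"
        unfolding D1_def by (rule integral_sqdist_ge_sq[OF fin ne]) (auto dest!: ge')
      then have D1': "79/1296 \<le> D1" by (simp add: power3_eq_cube)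
      have D2': "1 / 324 * (1 / (real n)\<^sup>2) \<le> D2"
        unfolding D2_def using fin ne card assms(1)
        by (intro interval_third_quantization(1)[of \<alpha> \<alpha>]) auto
      show False
      proof (cases "n = 3")
        case True
        then show False using T1 D1' D2' by (simp add: E_def)
      next
        case False
        then have "1 / (real (n - 1))\<^sup>2 \<le> 1 / 3\<^sup>2"
          using assms(1) by (intro divide_left_mono power_mono) auto
        then show False using T1 D1' D(2) by (simp add: E_def)
      qed
    qed
  qed

  have B_ne: "B \<noteq> {}"
  proof
    assume "B = {}"
    then have less: "a < 1/2" if "a \<in> \<alpha>" for a using that by (force simp: B_def)
    have "((1 - 1/2) ^ 3 - (2/3 - 1/2) ^ 3) / 3 \<le> D2"
      unfolding D2_def by (rule integral_sqdist_ge_sq[OF fin ne]) (auto dest!: less)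
    then have D2': "13/324 \<le> D2" by (simp add: power3_eq_cube)
    have "1 / (real (n - 1))\<^sup>2 \<le> 1 / 2\<^sup>2"
      using assms(1) by (intro divide_left_mono power_mono) auto
    then show False using T1 D2' D(1) by (simp add: E_def)
  qed

  define m where "m = card A"
  have cA: "1 \<le> m" and cB: "1 \<le> card B"
    using A_ne B_ne AB by (auto simp: m_def Suc_le_eq card_gt_0_iff)
  have m: "m + (n - m) = n" "1 \<le> n - m" "card B \<le> n - m" using cA cB cAB by (auto simp: m_def)
  have r: "1 / (6 * real m) \<le> 1 / 6" "1 / (6 * real (n - m)) \<le> 1 / 6"
    using cA m(2) by (auto intro!: divide_left_mono)
  have farA: "a \<le> 0 - 1 / (6 * real m) \<or> 1/3 + 1 / (6 * real m) \<le> a" if "a \<in> \<alpha> - A" for a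
    using that r(1) by (auto simp: A_def)
  have farB: "a \<le> 2/3 - 1 / (6 * real (n - m)) \<or> 1 + 1 / (6 * real (n - m)) \<le> a" if "a \<in> \<alpha> - B" for a
    using that r(2) by (auto simp: B_def)
  have sub_AB: "A \<subseteq> \<alpha>" "B \<subseteq> \<alpha>" and mA: "card A \<le> m" using AB(1) by (auto simp: m_def)
  have len: "1/3 = 0 + (1/3 :: real)" "1 = 2/3 + (1/3 :: real)" by simp_all
  note q1 = interval_third_quantization[OF fin ne sub_AB(1) mA cA len(1) farA, folded D1_def]
  note q2 = interval_third_quantization[OF fin ne sub_AB(2) m(3,2) len(2) farB, folded D2_def]
  \<comment> \<open>the grids with \<open>m\<close> and \<open>n - m\<close> points have at most the sum of the two lower bounds as their error\<close>
  have "3/100 * D1 + 297/100 * D2 \<le> E m (n - m)" using T cA m by simp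
  then have eq: "D1 = 1 / 324 * (1 / (real m)\<^sup>2)" "D2 = 1 / 324 * (1 / (real (n - m))\<^sup>2)"
    using q1(1) q2(1) by (simp_all add: E_def)
  have sub: "A \<subseteq> J1" "B \<subseteq> J2" "card B = n - m" using q1(2) q2(2) eq by (auto simp: J1_def J2_def)
  have AJ: "\<alpha> \<inter> J1 = A" and BJ: "\<alpha> \<inter> J2 = B"
    using sub sub_AB by (force simp: J1_def J2_def A_def B_def)+
  have km: "k = m" using assms(3) AJ by (simp add: m_def)

  \<comment> \<open>the gap is as wide as either interval, so a point of the other interval is never strictly
      closer; hence each part alone serves its interval as well as the whole set does\<close>
  have sA: "sqdist A x \<le> sqdist \<alpha> x" if x: "x \<in> {0..1/3}" for x
  proof -
    obtain a where a: "a \<in> \<alpha>" "sqdist \<alpha> x = (x - a)\<^sup>2" using sqdist_attained fin ne by metis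
    obtain a' where a': "a' \<in> A" using A_ne by blast
    have "\<exists>b\<in>A. \<bar>x - b\<bar> \<le> \<bar>x - a\<bar>"
      using a a' AB sub x by (cases "a \<in> A") (force simp: J1_def J2_def)+
    then show ?thesis using sqdist_le[OF AB(3)] a by (metis abs_le_square_iff order_trans)
  qed
  have sB: "sqdist B x \<le> sqdist \<alpha> x" if x: "x \<in> {2/3..1}" for x
  proof -
    obtain a where a: "a \<in> \<alpha>" "sqdist \<alpha> x = (x - a)\<^sup>2" using sqdist_attained fin ne by metis
    obtain b' where b': "b' \<in> B" using B_ne by blast
    have "\<exists>b\<in>B. \<bar>x - b\<bar> \<le> \<bar>x - a\<bar>"
      using a b' AB sub x by (cases "a \<in> B") (force simp: J1_def J2_def)+
    then show ?thesis using sqdist_le[OF AB(4)] a by (metis abs_le_square_iff order_trans)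
  qed
  have "integral {0..1/3} (sqdist A) \<le> D1"
    unfolding D1_def using sA AB A_ne fin ne by (intro integral_le sqdist_integrable) auto
  then have oA: "optimal_means m P1 A"
    unfolding P1_def J1_def using eq(1) AB A_ne cA
    by (intro optimal_means_uniform) (auto simp: m_def power3_eq_cube)
  have "integral {2/3..1} (sqdist B) \<le> D2"
    unfolding D2_def using sB AB B_ne fin ne by (intro integral_le sqdist_integrable) auto
  then have oB: "optimal_means (n - m) P2 B"
    unfolding P2_def J2_def using eq(2) AB B_ne m
    by (intro optimal_means_uniform) (auto simp: power3_eq_cube)
  have "quantization_error n P = ennreal (E m (n - m))"
    unfolding V by (rule arg_cong[where f = ennreal]) (simp add: eq E_def)
  then show ?thesis
    using oA oB sub(3) AB(1) unfolding AJ BJ km E_def by simp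
qed

end
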